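(* Let $0\le k\le d$, let $C\subseteq\mathbb{R}^d$ be a polyhedral cone and let $H\subset\mathbb{R}^d$ be a linear hyperplane with closed halfspaces $H^{\le},H^{\ge}$. Then \[ V_k(C) \ = \ V_k(C\cap H^{\le}) + V_k(C\cap H^{\ge}) - V_k(C\cap H) \] as simple indicator functions, i.e. as elements of $\mathfrak{S}_d$.
   Context: Polyhedral cones are nonempty and contain the origin; $\mathbf{Cones}_d$ is the set of polyhedral cones in $\mathbb{R}^d$. For $S\subseteq\mathbb{R}^d$, $[S]:\mathbb{R}^d\to\{0,1\}$ is the indicator function of $S$. $\mathfrak{C}_d$ is the abelian group of functions $\mathbb{R}^d\to\mathbb{Z}$ spanned by all $[C]$, $C\in\mathbf{Cones}_d$, and the group of simple indicator functions is the quotient $\mathfrak{S}_d=\mathfrak{C}_d/\langle [C] : C\in\mathbf{Cones}_d,\ \dim C<d\rangle$. For a cone $C$, $\mathcal{F}_k(C)$ is the set of $k$-dimensional faces of $C$ (nonempty faces, including $C$ itself). For a nonempty face $F$ of $C$, the normal cone is $N_FC=\{c\in\mathbb{R}^d : \langle c,x\rangle\le\langle c,y\rangle \text{ for all } x\in C,\ y\in F\}$, and $\Pi_F(C)=F+N_FC$, a full-dimensional polyhedral cone (the closure of the set of points whose nearest point in $C$ lies in the relative interior of $F$). Define $V_k(C)=\sum_{F\in\mathcal{F}_k(C)}[\Pi_F(C)]\in\mathfrak{C}_d$, viewed also as an element of $\mathfrak{S}_d$ via the quotient map. *)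

theory Defs
  imports "HOL-Analysis.Analysis" "HOL-Algebra.Coset" "HOL-Algebra.Generated_Groups"
begin

definition polyhedral_cone :: "'a::euclidean_space set \<Rightarrow> bool" where
  "polyhedral_cone C \<longleftrightarrow> polyhedron C \<and> conic C \<and> 0 \<in> C"

text \<open>HOL-Algebra groups are written multiplicatively, so in the groups below \<open>\<otimes>\<close> is
  addition and \<open>inv\<close> is negation of integer-valued functions (respectively of their classes).\<close>

definition int_function_group :: "('a \<Rightarrow> int) monoid" where
  "int_function_group = \<lparr>carrier = UNIV, mult = (\<lambda>f g x. f x + g x), one = (\<lambda>x. 0)\<rparr>"

definition cone_functions :: "('a::euclidean_space \<Rightarrow> int) monoid" where
  "cone_functions = subgroup_generated int_function_group {indicator C |C. polyhedral_cone C}"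

definition low_dim_functions :: "('a::euclidean_space \<Rightarrow> int) set" where
  "low_dim_functions =
    generate cone_functions {indicator C |C. polyhedral_cone C \<and> aff_dim C < DIM('a)}"

definition simple_functions :: "('a::euclidean_space \<Rightarrow> int) set monoid" where
  "simple_functions = cone_functions Mod low_dim_functions"

text \<open>The quotient map; it is meant to be applied to elements of the carrier of
  \<^const>\<open>cone_functions\<close>.\<close>

definition simple_class :: "('a::euclidean_space \<Rightarrow> int) \<Rightarrow> ('a \<Rightarrow> int) set" where
  "simple_class f = low_dim_functions #>\<^bsub>cone_functions\<^esub> f"

text \<open>\<^const>\<open>face_of\<close> also admits the empty set as a face, which is excluded here.\<close>

definition k_faces :: "nat \<Rightarrow> 'a::euclidean_space set \<Rightarrow> 'a set set" where
  "k_faces k C = {F. F face_of C \<and> F \<noteq> {} \<and> aff_dim F = int k}"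

definition normal_cone :: "'a::euclidean_space set \<Rightarrow> 'a set \<Rightarrow> 'a set" where
  "normal_cone C F = {c. \<forall>x\<in>C. \<forall>y\<in>F. c \<bullet> x \<le> c \<bullet> y}"

definition face_region :: "'a::euclidean_space set \<Rightarrow> 'a set \<Rightarrow> 'a set" where
  "face_region C F = {y + c |y c. y \<in> F \<and> c \<in> normal_cone C F}"

definition V :: "nat \<Rightarrow> 'a::euclidean_space set \<Rightarrow> 'a \<Rightarrow> int" where
  "V k C = (\<lambda>x. \<Sum>F\<in>k_faces k C. indicator (face_region C F) x)"

lemma comm_group_int_function_group: "comm_group (int_function_group :: ('a \<Rightarrow> int) monoid)"
proof (rule comm_groupI)
  fix f :: "'a \<Rightarrow> int"
  show "\<exists>g\<in>carrier int_function_group. g \<otimes>\<^bsub>int_function_group\<^esub> f = \<one>\<^bsub>int_function_group\<^esub>"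
    by (rule bexI[of _ "\<lambda>x. - f x"]) (auto simp: int_function_group_def)
qed (auto simp: int_function_group_def)

lemma comm_group_cone_functions: "comm_group cone_functions"
  unfolding cone_functions_def
  by (rule group.abelian_subgroup_generated)
     (use comm_group_int_function_group in \<open>auto simp: comm_group_def\<close>)

lemma indicator_in_cone_functions:
  "polyhedral_cone C \<Longrightarrow> indicator C \<in> carrier cone_functions"
  unfolding cone_functions_def carrier_subgroup_generated
  by (rule generate.incl) (auto simp: int_function_group_def)

lemma subgroup_low_dim_functions: "subgroup low_dim_functions cone_functions"
  unfolding low_dim_functions_def
  by (rule group.generate_is_subgroup)
     (use comm_group_cone_functions in \<open>auto simp: comm_group_def indicator_in_cone_functions\<close>)

lemma comm_group_simple_functions: "comm_group simple_functions"
  unfolding simple_functions_def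
  by (rule comm_group.abelian_FactGroup[OF comm_group_cone_functions subgroup_low_dim_functions])

end

theory Submission
  imports Defs
begin

text \<open>For \<open>x\<close> in the ambient space let \<open>p = closest_point C x\<close>. A point \<open>x\<close> lies in
  \<open>face_region C F\<close> exactly when \<open>p \<in> F\<close> and \<open>x - p\<close> is normal to \<open>C\<close> along \<open>F\<close>. One such
  face is the face \<open>G\<close> with \<open>p\<close> in its relative interior, and it is the only one unless \<open>x\<close> lies
  in \<open>K + normal_cone C F\<close> for some face \<open>K\<close> of smaller dimension contained in a face \<open>F\<close>; as
  \<open>normal_cone C F\<close> is orthogonal to \<open>F\<close>, such sums are contained in hyperplanes. So, off finitely
  many hyperplanes, \<open>V k C x\<close> is 1 if \<open>dim G = k\<close> and 0 otherwise (\<open>V_eq_face_dimension\<close>).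

  The valuation identity can then be checked at one generic \<open>x\<close>, according to the position of \<open>p\<close>
  relative to the hyperplane \<open>H\<close> (\<open>V_split_at_generic_point\<close>). Suppose that \<open>p\<close> is strictly on the
  \<open>\<le>\<close> side. Cutting \<open>C\<close> by that closed halfspace changes nothing near \<open>p\<close>, so it keeps the
  nearest point and the dimension of its face. The nearest point \<open>q\<close> in the other half of \<open>C\<close> must
  lie on \<open>H\<close>, so it is also the nearest point in \<open>C \<inter> H\<close>; since \<open>C \<inter> H\<close> is a face of that
  half, \<open>q\<close> is in the relative interior of the same face of both, and the two contributions
  cancel. If \<open>p\<close> is on \<open>H\<close>, all four nearest points are \<open>p\<close>, and for generic \<open>x\<close> its face in
  \<open>C\<close> has the same dimension as the common face in the three other cones.

  It remains to pass from generic points to \<open>simple_functions\<close>. A combination of indicators of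
  cones that vanishes off finitely many hyperplanes is a combination of indicators of
  lower-dimensional cones, because restricting it to a hyperplane intersects every cone with that
  hyperplane (\<open>low_dim_if_thin_support\<close>). For this to apply, the face regions must be polyhedral
  cones (\<open>polyhedral_cone_face_region\<close>).\<close>

section \<open>Pointwise arithmetic in the group of cone functions\<close>

lemma inv_int_function_group: "inv\<^bsub>int_function_group\<^esub> f = (\<lambda>x. - f x)"
  by (rule group.inv_equality)
    (use comm_group_int_function_group in \<open>auto simp: comm_group_def int_function_group_def\<close>)

lemma mult_cone_functions: "f \<otimes>\<^bsub>cone_functions\<^esub> g = (\<lambda>x. f x + g x)"
  by (simp add: cone_functions_def subgroup_generated_def int_function_group_def)

lemma one_cone_functions: "\<one>\<^bsub>cone_functions\<^esub> = (\<lambda>x. 0)"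
  by (simp add: cone_functions_def subgroup_generated_def int_function_group_def)

lemma inv_cone_functions:
  assumes "f \<in> carrier cone_functions"
  shows "inv\<^bsub>cone_functions\<^esub> f = (\<lambda>x. - f x)"
  using assms comm_group_int_function_group group.inv_subgroup_generated inv_int_function_group
  unfolding cone_functions_def comm_group_def by fastforce

lemma cone_functions_zero: "(\<lambda>x. 0) \<in> carrier cone_functions"
  and cone_functions_add:
    "\<lbrakk>f \<in> carrier cone_functions; g \<in> carrier cone_functions\<rbrakk>
      \<Longrightarrow> (\<lambda>x. f x + g x) \<in> carrier cone_functions"
  and cone_functions_uminus:
    "f \<in> carrier cone_functions \<Longrightarrow> (\<lambda>x. - f x) \<in> carrier cone_functions"
proof -
  interpret comm_group cone_functions by (rule comm_group_cone_functions)
  show "(\<lambda>x. 0) \<in> carrier cone_functions"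
    using one_closed by (simp add: one_cone_functions)
  show "(\<lambda>x. f x + g x) \<in> carrier cone_functions"
    if "f \<in> carrier cone_functions" "g \<in> carrier cone_functions"
    using m_closed[OF that] by (simp add: mult_cone_functions)
  show "(\<lambda>x. - f x) \<in> carrier cone_functions" if "f \<in> carrier cone_functions"
    using inv_closed[OF that] that by (simp add: inv_cone_functions)
qed

lemma cone_functions_diff:
  "\<lbrakk>f \<in> carrier cone_functions; g \<in> carrier cone_functions\<rbrakk>
    \<Longrightarrow> (\<lambda>x. f x - g x) \<in> carrier cone_functions"
  using cone_functions_add[of f "\<lambda>x. - g x"] cone_functions_uminus[of g] by simp

lemma cone_functions_sum:
  assumes "\<And>i. i \<in> I \<Longrightarrow> f i \<in> carrier cone_functions"
  shows "(\<lambda>x. \<Sum>i\<in>I. f i x) \<in> carrier cone_functions"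
  using assms
  by (induction I rule: infinite_finite_induct)
    (auto simp: cone_functions_zero intro!: cone_functions_add)

lemma low_dim_functions_subset: "f \<in> low_dim_functions \<Longrightarrow> f \<in> carrier cone_functions"
  using subgroup.subset[OF subgroup_low_dim_functions] by blast

lemma low_dim_functions_zero: "(\<lambda>x. 0) \<in> low_dim_functions"
  using subgroup.one_closed[OF subgroup_low_dim_functions] by (simp add: one_cone_functions)

lemma low_dim_functions_add:
  "\<lbrakk>f \<in> low_dim_functions; g \<in> low_dim_functions\<rbrakk> \<Longrightarrow> (\<lambda>x. f x + g x) \<in> low_dim_functions"
  using subgroup.m_closed[OF subgroup_low_dim_functions, of f g] by (simp add: mult_cone_functions)

lemma low_dim_functions_uminus:
  "f \<in> low_dim_functions \<Longrightarrow> (\<lambda>x. - f x) \<in> low_dim_functions"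
  using subgroup.m_inv_closed[OF subgroup_low_dim_functions, of f]
  by (simp add: inv_cone_functions low_dim_functions_subset)

section \<open>Cone functions supported on finitely many hyperplanes\<close>

lemma polyhedral_cone_Int:
  "\<lbrakk>polyhedral_cone C; polyhedral_cone D\<rbrakk> \<Longrightarrow> polyhedral_cone (C \<inter> D)"
  by (auto simp: polyhedral_cone_def conic_def)

lemma polyhedral_cone_hyperplane: "polyhedral_cone {x. a \<bullet> x = 0}"
  and polyhedral_cone_halfspace_le: "polyhedral_cone {x. a \<bullet> x \<le> 0}"
  and polyhedral_cone_halfspace_ge: "polyhedral_cone {x. 0 \<le> a \<bullet> x}"
  using polyhedron_halfspace_ge[of 0 a]
  by (auto simp: polyhedral_cone_def conic_def polyhedron_hyperplane polyhedron_halfspace_le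
      mult_nonneg_nonpos)

text \<open>Multiplying by the indicator of a hyperplane is additive and turns the indicator of a cone \<open>C\<close>
  into that of a section of \<open>C\<close>, which is too small to be full-dimensional.\<close>

lemma restrict_hyperplane_low_dim:
  fixes b :: "'a::euclidean_space"
  assumes "b \<noteq> 0" and "f \<in> carrier cone_functions"
  shows "(\<lambda>x. f x * indicator {x. b \<bullet> x = 0} x) \<in> low_dim_functions"
proof -
  let ?H = "{x. b \<bullet> x = 0}"
  have cone: "(\<lambda>x. indicator C x * indicator ?H x) \<in> low_dim_functions"
    if "polyhedral_cone C" for C :: "'a set"
  proof -
    have "aff_dim (C \<inter> ?H) \<le> aff_dim ?H"
      by (simp add: aff_dim_subset)
    also have "\<dots> < DIM('a)"
      using \<open>b \<noteq> 0\<close> by simp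
    finally have "indicator (C \<inter> ?H) \<in> (low_dim_functions :: ('a \<Rightarrow> int) set)"
      unfolding low_dim_functions_def
      using that polyhedral_cone_Int[OF that polyhedral_cone_hyperplane]
      by (intro generate.incl) blast
    moreover have "indicator (C \<inter> ?H) = (\<lambda>x. indicator C x * indicator ?H x :: int)"
      by (auto simp: indicator_def)
    ultimately show ?thesis by simp
  qed
  have "f \<in> generate int_function_group {indicator C |C. polyhedral_cone C}"
    using assms(2) by (simp add: cone_functions_def carrier_subgroup_generated int_function_group_def)
  then show ?thesis
  proof (induction rule: generate.induct)
    case one
    then show ?case by (simp add: int_function_group_def low_dim_functions_zero)
  next
    case (incl h)
    then show ?case using cone by auto
  next
    case (inv h)
    then show ?case
      using cone low_dim_functions_uminus by (fastforce simp: inv_int_function_group)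
  next
    case (eng f g)
    then show ?case
      using low_dim_functions_add by (fastforce simp: int_function_group_def distrib_right)
  qed
qed

text \<open>The exceptional sets have to be recorded as subsets of finitely many hyperplanes rather than as
  null sets: the hyperplanes are what a cone function is restricted to below.\<close>

definition thin :: "'a::euclidean_space set \<Rightarrow> bool" where
  "thin A \<longleftrightarrow> (\<exists>B. finite B \<and> 0 \<notin> B \<and> A \<subseteq> (\<Union>b\<in>B. {x. b \<bullet> x = 0}))"

lemma thin_subset: "\<lbrakk>thin B; A \<subseteq> B\<rbrakk> \<Longrightarrow> thin A"
  unfolding thin_def by blast

lemma thin_empty: "thin {}"
  unfolding thin_def by blast

lemma thin_Un: "\<lbrakk>thin A; thin B\<rbrakk> \<Longrightarrow> thin (A \<union> B)"
  unfolding thin_def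
  by (elim exE, rename_tac S T, rule_tac x="S \<union> T" in exI) auto

lemma thin_UN: "\<lbrakk>finite I; \<And>i. i \<in> I \<Longrightarrow> thin (A i)\<rbrakk> \<Longrightarrow> thin (\<Union>i\<in>I. A i)"
  by (induction I rule: finite_induct) (auto simp: thin_empty thin_Un)

text \<open>The hyperplanes are peeled off one at a time: subtracting from \<open>f\<close> its restriction to one of
  them costs an element of \<^const>\<open>low_dim_functions\<close> and leaves a cone function supported on the
  remaining ones.\<close>

lemma low_dim_if_thin_support:
  fixes f :: "'a::euclidean_space \<Rightarrow> int"
  assumes "f \<in> carrier cone_functions" and "thin {x. f x \<noteq> 0}"
  shows "f \<in> low_dim_functions"
proof -
  obtain B :: "'a set" where "finite B" "0 \<notin> B" "{x. f x \<noteq> 0} \<subseteq> (\<Union>b\<in>B. {x. b \<bullet> x = 0})"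
    using assms(2) unfolding thin_def by blast
  then show ?thesis
    using assms(1)
  proof (induction B arbitrary: f rule: finite_induct)
    case empty
    then have "f = (\<lambda>x. 0)" by auto
    then show ?case by (simp add: low_dim_functions_zero)
  next
    case (insert b B)
    let ?g = "\<lambda>x. f x * indicator {x. b \<bullet> x = 0} x"
    have g: "?g \<in> low_dim_functions"
      using insert by (intro restrict_hyperplane_low_dim) auto
    have "(\<lambda>x. f x - ?g x) \<in> low_dim_functions"
    proof (rule insert.IH)
      show "(\<lambda>x. f x - ?g x) \<in> carrier cone_functions"
        using cone_functions_diff insert.prems(3) low_dim_functions_subset[OF g] by blast
      show "{x. f x - ?g x \<noteq> 0} \<subseteq> (\<Union>b\<in>B. {x. b \<bullet> x = 0})"
        using insert.prems(2) by (auto simp: indicator_def)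
    qed (use insert.prems in auto)
    from low_dim_functions_add[OF g this] show ?case by simp
  qed
qed

section \<open>Face regions are polyhedral cones\<close>

lemma polyhedral_cone_face:
  assumes "polyhedral_cone C" "F face_of C" "F \<noteq> {}"
  shows "polyhedral_cone F"
  using assms face_of_conic face_of_polyhedron_polyhedron conic_contains_0
  unfolding polyhedral_cone_def by blast

text \<open>The preimage of a halfspace is again a halfspace, with normal vector \<open>adjoint f a\<close>. That
  vector may vanish.\<close>

lemma polyhedron_linear_vimage:
  fixes f :: "'a::euclidean_space \<Rightarrow> 'b::euclidean_space"
  assumes "linear f" "polyhedron S"
  shows "polyhedron (f -` S)"
proof -
  obtain \<F> where \<F>: "finite \<F>" "S = \<Inter>\<F>" "\<And>h. h \<in> \<F> \<Longrightarrow> \<exists>a b. a \<noteq> 0 \<and> h = {x. a \<bullet> x \<le> b}"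
    using assms(2) unfolding polyhedron_def by blast
  have half: "polyhedron (f -` h)" if h: "h \<in> \<F>" for h
  proof -
    obtain a b where "h = {x. a \<bullet> x \<le> b}" using \<F>(3)[OF h] by blast
    then have "f -` h = {x. adjoint f a \<bullet> x \<le> b}"
      by (auto simp: adjoint_works[OF assms(1)] inner_commute)
    then show ?thesis by (simp add: polyhedron_halfspace_le)
  qed
  have "f -` S = \<Inter>((\<lambda>h. f -` h) ` \<F>)" using \<F>(2) by auto
  then show ?thesis using half \<F>(1) by auto
qed

lemma normal_cone_orthogonal:
  assumes "F \<subseteq> C" "0 \<in> F" "c \<in> normal_cone C F" "y \<in> F"
  shows "c \<bullet> y = 0"
proof (rule antisym)
  show "c \<bullet> y \<le> 0"
    using assms inner_zero_right[of c] unfolding normal_cone_def by fastforce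
  show "0 \<le> c \<bullet> y"
    using assms inner_zero_right[of c] unfolding normal_cone_def by fastforce
qed

text \<open>The defining inequalities of a normal cone range over all points of \<open>C\<close> and \<open>F\<close>. By
  homogeneity it is enough to impose them inside the box \<open>B\<close>, where \<open>C\<close> and \<open>F\<close> become polytopes,
  and there only at pairs of points of two finite sets whose convex hulls these polytopes are.\<close>

lemma polyhedral_cone_normal_cone:
  fixes C :: "'a::euclidean_space set"
  assumes C: "polyhedral_cone C" and F: "polyhedral_cone F"
  shows "polyhedral_cone (normal_cone C F)"
proof -
  define B :: "'a set" where "B = cbox (- One) One"
  have polytope_B: "polytope (D \<inter> B)" if "polyhedral_cone D" for D
    using that polyhedral_cone_def unfolding B_def
    by (metis inf_commute polytope_Int_polyhedron polytope_interval)
  have scale: "\<exists>e>0. \<forall>t. 0 \<le> t \<and> t \<le> e \<longrightarrow> t *\<^sub>R x \<in> B" for x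
  proof (intro exI conjI allI impI)
    show "0 < inverse (norm x + 1)" by (simp add: add_nonneg_pos)
    fix t assume t: "0 \<le> t \<and> t \<le> inverse (norm x + 1)"
    have "\<bar>t * (x \<bullet> i)\<bar> \<le> 1" if "i \<in> Basis" for i
    proof -
      have "\<bar>t * (x \<bullet> i)\<bar> \<le> inverse (norm x + 1) * (norm x + 1)"
        unfolding abs_mult using t Basis_le_norm[OF that, of x] by (intro mult_mono) auto
      also have "\<dots> = 1"
        by (smt (verit) left_inverse norm_ge_zero)
      finally show ?thesis .
    qed
    then show "t *\<^sub>R x \<in> B"
      unfolding B_def mem_box by (auto simp: abs_le_iff)
  qed
  obtain S where S: "finite S" "C \<inter> B = convex hull S"
    using polytope_B[OF C] unfolding polytope_def by blast
  obtain T where T: "finite T" "F \<inter> B = convex hull T"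
    using polytope_B[OF F] unfolding polytope_def by blast
  have "normal_cone C F = (\<Inter>(s,t)\<in>S \<times> T. {c. (s - t) \<bullet> c \<le> 0})" (is "_ = ?R")
  proof (intro antisym subsetI)
    fix c assume "c \<in> normal_cone C F"
    moreover have "S \<subseteq> C" "T \<subseteq> F"
      using S(2) T(2) hull_subset[of S convex] hull_subset[of T convex] by auto
    ultimately show "c \<in> ?R"
      by (auto simp: normal_cone_def inner_diff_left inner_commute[of _ c])
  next
    fix c assume c: "c \<in> ?R"
    have "c \<bullet> s \<le> c \<bullet> t" if "s \<in> S" "t \<in> T" for s t
      using c that by (auto simp: inner_diff_left inner_commute[of _ c])
    then have "convex hull S \<subseteq> {x. c \<bullet> x \<le> c \<bullet> t}" if "t \<in> T" for t
      using that by (intro hull_minimal) (auto simp: convex_halfspace_le)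
    then have "convex hull T \<subseteq> {y. c \<bullet> x \<le> c \<bullet> y}" if "x \<in> C \<inter> B" for x
      using that S(2) by (intro hull_minimal) (auto simp: convex_halfspace_ge)
    then have box: "c \<bullet> x \<le> c \<bullet> y" if "x \<in> C \<inter> B" "y \<in> F \<inter> B" for x y
      using that T(2) by blast
    have "c \<bullet> x \<le> c \<bullet> y" if xy: "x \<in> C" "y \<in> F" for x y
    proof -
      obtain d e where de: "d > 0" "e > 0" "\<And>t. 0 \<le> t \<Longrightarrow> t \<le> d \<Longrightarrow> t *\<^sub>R x \<in> B"
        "\<And>t. 0 \<le> t \<Longrightarrow> t \<le> e \<Longrightarrow> t *\<^sub>R y \<in> B"
        using scale[of x] scale[of y] by blast
      let ?t = "min d e"
      have "c \<bullet> (?t *\<^sub>R x) \<le> c \<bullet> (?t *\<^sub>R y)"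
        using de xy C F unfolding polyhedral_cone_def
        by (intro box IntI) (auto intro!: conicD)
      then show ?thesis using de(1,2) by (simp add: mult_le_cancel_left)
    qed
    then show "c \<in> normal_cone C F" by (simp add: normal_cone_def)
  qed
  moreover have "polyhedron ?R"
    using S(1) T(1) polyhedron_halfspace_le by (intro polyhedron_Inter) auto
  moreover have "conic (normal_cone C F)" "0 \<in> normal_cone C F"
    by (auto simp: conic_def normal_cone_def mult_left_mono)
  ultimately show ?thesis by (simp add: polyhedral_cone_def)
qed

lemma orthogonal_projection_exists:
  fixes U :: "'a::euclidean_space set"
  obtains P :: "'a \<Rightarrow> 'a" where "linear P" "\<And>y. y \<in> U \<Longrightarrow> P y = y"
    "\<And>c. (\<And>y. y \<in> U \<Longrightarrow> c \<bullet> y = 0) \<Longrightarrow> P c = 0"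
proof -
  obtain B where B: "B \<subseteq> span U" "pairwise orthogonal B" "\<And>x. x \<in> B \<Longrightarrow> norm x = 1"
    "independent B" "span B = span U"
    by (metis orthonormal_basis_subspace subspace_span)
  have fin: "finite B" using B(4) independent_imp_finite by blast
  define P where "P x = (\<Sum>b\<in>B. (b \<bullet> x) *\<^sub>R b)" for x
  have lin: "linear P"
    unfolding P_def by (rule linearI)
      (simp_all add: inner_add_right scaleR_add_left sum.distrib scaleR_sum_right)
  have onB: "P x = x" if "x \<in> B" for x
  proof -
    have "(b \<bullet> x) *\<^sub>R b = (if b = x then x else 0)" if "b \<in> B" for b
      using B(2,3) that \<open>x \<in> B\<close> by (auto simp: pairwise_def orthogonal_def norm_eq_1)
    then have "P x = (\<Sum>b\<in>B. if b = x then x else 0)"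
      unfolding P_def by (intro sum.cong) auto
    then show ?thesis using fin \<open>x \<in> B\<close> by simp
  qed
  show ?thesis
  proof
    show "linear P" by (rule lin)
    show "P y = y" if "y \<in> U" for y
      using linear_eq_on_span[OF lin linear_id, of B y] onB that B(5) span_base by auto
    show "P c = 0" if c: "\<And>y. y \<in> U \<Longrightarrow> c \<bullet> y = 0" for c
    proof -
      have "c \<bullet> b = 0" if "b \<in> B" for b
        using orthogonal_to_span[of b U c] c B(1) that by (auto simp: orthogonal_def)
      then show ?thesis by (auto simp: P_def inner_commute intro!: sum.neutral)
    qed
  qed
qed

text \<open>A sum of polyhedra is in general a projection, but here the two summands lie in orthogonal
  subspaces. With the orthogonal projection \<open>P\<close> onto the span of \<open>F\<close>, the sum is the intersection
  of the preimage of \<open>F\<close> under \<open>P\<close> with the preimage of the normal cone under \<open>id - P\<close>.\<close>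

lemma polyhedral_cone_face_region:
  fixes C :: "'a::euclidean_space set"
  assumes C: "polyhedral_cone C" and F: "F face_of C" "F \<noteq> {}"
  shows "polyhedral_cone (face_region C F)"
proof -
  let ?N = "normal_cone C F"
  have pF: "polyhedral_cone F" using polyhedral_cone_face assms by blast
  have pN: "polyhedral_cone ?N" using polyhedral_cone_normal_cone C pF by blast
  obtain P where P: "linear P" "\<And>y. y \<in> F \<Longrightarrow> P y = y"
    "\<And>c. (\<And>y. y \<in> F \<Longrightarrow> c \<bullet> y = 0) \<Longrightarrow> P c = 0"
    by (rule orthogonal_projection_exists[of F]) blast
  have PN: "P c = 0" if "c \<in> ?N" for c
    using that P(3) normal_cone_orthogonal face_of_imp_subset F(1) pF
    unfolding polyhedral_cone_def by blast
  have "face_region C F = P -` F \<inter> (\<lambda>x. x - P x) -` ?N"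
  proof (intro antisym subsetI)
    fix x assume "x \<in> face_region C F"
    then obtain y c where "x = y + c" "y \<in> F" "c \<in> ?N"
      unfolding face_region_def by blast
    then show "x \<in> P -` F \<inter> (\<lambda>x. x - P x) -` ?N"
      by (simp add: linear_add[OF P(1)] P(2) PN)
  next
    fix x assume x: "x \<in> P -` F \<inter> (\<lambda>x. x - P x) -` ?N"
    then have "P x \<in> F" "x - P x \<in> ?N" "x = P x + (x - P x)" by auto
    then show "x \<in> face_region C F"
      unfolding face_region_def by blast
  qed
  moreover have Q: "linear (\<lambda>x. x - P x)"
    using linear_compose_sub[OF linear_id P(1)] by simp
  ultimately have "polyhedron (face_region C F)"
    using polyhedron_Int[OF polyhedron_linear_vimage[OF P(1)] polyhedron_linear_vimage[OF Q]] pF pN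
    unfolding polyhedral_cone_def by simp
  moreover have "conic (face_region C F)"
    unfolding conic_def
  proof (intro allI impI)
    fix x and t :: real assume "x \<in> face_region C F" "0 \<le> t"
    then obtain y c where yc: "x = y + c" "y \<in> F" "c \<in> ?N"
      unfolding face_region_def by blast
    have "t *\<^sub>R y \<in> F" "t *\<^sub>R c \<in> ?N"
      using pF pN yc \<open>0 \<le> t\<close> conicD unfolding polyhedral_cone_def by blast+
    then show "t *\<^sub>R x \<in> face_region C F"
      unfolding face_region_def yc(1) scaleR_add_right by blast
  qed
  moreover have "0 \<in> face_region C F"
    using pF pN unfolding polyhedral_cone_def face_region_def by force
  ultimately show ?thesis by (simp add: polyhedral_cone_def)
qed

lemma V_in_cone_functions:
  assumes "polyhedral_cone C"
  shows "V k C \<in> carrier cone_functions"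
  unfolding V_def k_faces_def
  by (intro cone_functions_sum)
    (use assms indicator_in_cone_functions polyhedral_cone_face_region in blast)

section \<open>Nearest points and the face regions containing a generic point\<close>

text \<open>If \<open>x = y + c\<close> with \<open>y \<in> F\<close> and \<open>c\<close> normal to \<open>C\<close> along \<open>F\<close>, then \<open>y\<close> is a nearest point of \<open>C\<close>
  to \<open>x\<close>, and nearest points are unique.\<close>

lemma mem_face_region_iff:
  fixes C :: "'a::euclidean_space set"
  assumes "closed C" "convex C" "F \<subseteq> C"
  shows "x \<in> face_region C F \<longleftrightarrow> closest_point C x \<in> F \<and> x - closest_point C x \<in> normal_cone C F"
    (is "?L \<longleftrightarrow> ?R")
proof
  assume ?L
  then obtain y c where yc: "x = y + c" "y \<in> F" "c \<in> normal_cone C F"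
    unfolding face_region_def by blast
  have "dist x y \<le> dist x z" if "z \<in> C" for z
  proof -
    have "c \<bullet> z \<le> c \<bullet> y" using yc that by (auto simp: normal_cone_def)
    then have sq: "c \<bullet> c \<le> (c + (y - z)) \<bullet> (c + (y - z))"
      using inner_ge_zero[of "y - z"] inner_commute[of "y - z" c]
      by (simp add: inner_add_left inner_add_right inner_diff_right)
    have "x - y = c" "x - z = c + (y - z)" by (simp_all add: yc(1))
    then show ?thesis using sq by (simp only: dist_norm norm_le)
  qed
  then have y: "y = closest_point C x"
    using assms(3) yc(2) by (intro closest_point_unique assms(1,2)) auto
  have "x - y = c" by (simp add: yc(1))
  then show ?R using yc(2,3) unfolding y[symmetric] by simp
next
  assume ?R
  moreover have "x = closest_point C x + (x - closest_point C x)" by simp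
  ultimately show ?L unfolding face_region_def mem_Collect_eq by (intro exI conjI) auto
qed

text \<open>The linear functional \<open>x - p\<close> attains its maximum over \<open>C\<close> at the nearest point \<open>p\<close>. The
  maximizers form a face that meets the relative interior of \<open>G\<close>, hence contains \<open>G\<close>.\<close>

lemma residual_in_normal_cone:
  fixes C :: "'a::euclidean_space set"
  assumes "closed C" "convex C" "G face_of C" "closest_point C x \<in> rel_interior G"
  shows "x - closest_point C x \<in> normal_cone C G"
proof -
  define p n where "p = closest_point C x" and "n = x - p"
  have p: "p \<in> rel_interior G" using assms(4) by (simp add: p_def)
  then have pC: "p \<in> C"
    using rel_interior_subset[of G] face_of_imp_subset[OF assms(3)] by auto
  have le: "n \<bullet> z \<le> n \<bullet> p" if "z \<in> C" for z
    using closest_point_dot[OF assms(2,1) that, of x]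
    by (simp add: n_def p_def inner_diff_right)
  then have "C \<inter> {z. n \<bullet> z = n \<bullet> p} face_of C"
    by (intro face_of_Int_supporting_hyperplane_le assms(2))
  moreover have "(C \<inter> {z. n \<bullet> z = n \<bullet> p}) \<inter> rel_interior G \<noteq> {}"
    using p pC by auto
  ultimately have "G \<subseteq> C \<inter> {z. n \<bullet> z = n \<bullet> p}"
    by (rule subset_of_face_of[OF _ face_of_imp_subset[OF assms(3)]])
  then have "n \<bullet> z \<le> n \<bullet> y" if "z \<in> C" "y \<in> G" for z y
    using le[OF that(1)] that(2) by auto
  then have "n \<in> normal_cone C G" by (simp add: normal_cone_def)
  then show ?thesis by (simp add: n_def p_def)
qed

text \<open>Points whose nearest point in \<open>C\<close> sits on a slice by \<open>K\<close> that loses dimension in some face whose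
  region contains the point. Two kinds of sets \<open>K\<close> matter: faces of \<open>C\<close>, for the uniqueness of the
  face region, and the cutting hyperplane.\<close>

definition collapsing_points :: "'a::euclidean_space set \<Rightarrow> 'a set \<Rightarrow> 'a set" where
  "collapsing_points C K = (\<Union>F\<in>{F. F face_of C \<and> aff_dim (F \<inter> K) < aff_dim F}.
     {y + c |y c. y \<in> F \<inter> K \<and> c \<in> normal_cone C F})"

lemma aff_dim_le_if_not_collapsing:
  fixes C :: "'a::euclidean_space set"
  assumes "x \<notin> collapsing_points C K" "F face_of C"
    and "y \<in> F \<inter> K" "x - y \<in> normal_cone C F"
  shows "aff_dim (F \<inter> K) = aff_dim F"
proof (rule ccontr)
  assume "aff_dim (F \<inter> K) \<noteq> aff_dim F"
  then have "aff_dim (F \<inter> K) < aff_dim F"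
    using aff_dim_subset[of "F \<inter> K" F] by simp
  moreover have "x \<in> {y + c |y c. y \<in> F \<inter> K \<and> c \<in> normal_cone C F}"
    using assms(3,4) by (intro CollectI exI[of _ y] exI[of _ "x - y"]) simp
  ultimately have "x \<in> collapsing_points C K"
    using assms(2) unfolding collapsing_points_def by (intro UN_I) auto
  with assms(1) show False by simp
qed

text \<open>The vector \<open>b\<close> is chosen in the span of \<open>B\<close> and orthogonal to the smaller span of \<open>A\<close>; it is
  then orthogonal both to \<open>A\<close> and to the orthogonal complement of \<open>B\<close>.\<close>

lemma hyperplane_covers_orthogonal_sum:
  fixes A B :: "'a::euclidean_space set"
  assumes "A \<subseteq> B" "0 \<in> A" "aff_dim A < aff_dim B"
  obtains b where "b \<noteq> 0" "\<And>y c. \<lbrakk>y \<in> A; \<And>z. z \<in> B \<Longrightarrow> c \<bullet> z = 0\<rbrakk> \<Longrightarrow> b \<bullet> (y + c) = 0"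
proof -
  have "dim A < dim B"
    using assms aff_dim_zero[of A] aff_dim_zero[of B] hull_subset[of A affine] hull_subset[of B affine]
    by (simp add: subset_iff)
  then have "span A \<subset> span B"
    using span_mono[OF assms(1)] by (metis dim_span less_irrefl psubsetI)
  then obtain b where b: "b \<noteq> 0" "b \<in> span B" "\<And>y. y \<in> span A \<Longrightarrow> orthogonal b y"
    using orthogonal_to_subspace_exists_gen[of A B] by metis
  show ?thesis
  proof
    fix y c assume y: "y \<in> A" and c: "\<And>z. z \<in> B \<Longrightarrow> c \<bullet> z = 0"
    have "orthogonal c b"
      using orthogonal_to_span[OF b(2), of c] c by (simp add: orthogonal_def)
    then show "b \<bullet> (y + c) = 0"
      using b(3)[OF span_base[OF y]]
      by (simp add: orthogonal_def inner_add_right inner_commute)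
  qed (rule b(1))
qed

lemma thin_collapsing_points:
  fixes C :: "'a::euclidean_space set"
  assumes C: "polyhedral_cone C" and K: "0 \<in> K"
  shows "thin (collapsing_points C K)"
  unfolding collapsing_points_def
proof (rule thin_UN)
  show "finite {F. F face_of C \<and> aff_dim (F \<inter> K) < aff_dim F}"
    using finite_polyhedron_faces[of C] C unfolding polyhedral_cone_def by simp
  fix F assume "F \<in> {F. F face_of C \<and> aff_dim (F \<inter> K) < aff_dim F}"
  then have F: "F face_of C" "aff_dim (F \<inter> K) < aff_dim F" by auto
  then have "F \<noteq> {}" by auto
  then have 0: "0 \<in> F"
    using polyhedral_cone_face[OF C F(1)] unfolding polyhedral_cone_def by blast
  obtain b where b: "b \<noteq> 0"
    "\<And>y c. \<lbrakk>y \<in> F \<inter> K; \<And>z. z \<in> F \<Longrightarrow> c \<bullet> z = 0\<rbrakk> \<Longrightarrow> b \<bullet> (y + c) = 0"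
    using hyperplane_covers_orthogonal_sum[of "F \<inter> K" F] F(2) 0 K by blast
  have "{y + c |y c. y \<in> F \<inter> K \<and> c \<in> normal_cone C F} \<subseteq> {x. b \<bullet> x = 0}"
    using b(2) normal_cone_orthogonal[OF face_of_imp_subset[OF F(1)] 0] by blast
  then show "thin {y + c |y c. y \<in> F \<inter> K \<and> c \<in> normal_cone C F}"
    unfolding thin_def using b(1) by (intro exI[of _ "{b}"]) auto
qed

text \<open>A minimal face containing \<open>p\<close> works: otherwise \<open>p\<close> would lie in one of its facets.\<close>

lemma face_containing_in_rel_interior:
  fixes S :: "'a::euclidean_space set"
  assumes "polyhedron S" "p \<in> S"
  obtains G where "G face_of S" "p \<in> rel_interior G"
proof -
  let ?A = "{F. F face_of S \<and> p \<in> F}"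
  have "finite ?A" "?A \<noteq> {}"
    using finite_polyhedron_faces[OF assms(1)] assms face_of_refl polyhedron_imp_convex by auto
  then obtain G where G: "G \<in> ?A" "\<And>F. F \<in> ?A \<Longrightarrow> F \<subseteq> G \<Longrightarrow> G = F"
    using finite_has_minimal[of ?A] by blast
  have "p \<in> rel_interior G"
  proof (rule ccontr)
    assume "p \<notin> rel_interior G"
    moreover have "polyhedron G"
      using face_of_polyhedron_polyhedron assms(1) G(1) by blast
    ultimately obtain F where F: "F facet_of G" "p \<in> F"
      using rel_boundary_of_polyhedron[of G] G(1) by blast
    then have "F face_of G" "F \<noteq> G"
      by (auto simp: facet_of_def)
    moreover from this have "F \<in> ?A" "F \<subseteq> G"
      using F(2) G(1) face_of_trans face_of_imp_subset by blast+
    ultimately show False using G(2) by blast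
  qed
  then show thesis using that G(1) by blast
qed

text \<open>Off this set the face whose region contains a given point is unique.\<close>

definition ambiguous_points :: "'a::euclidean_space set \<Rightarrow> 'a set" where
  "ambiguous_points C = (\<Union>G\<in>{G. G face_of C \<and> G \<noteq> {}}. collapsing_points C G)"

lemma thin_ambiguous_points:
  assumes "polyhedral_cone C"
  shows "thin (ambiguous_points C)"
  unfolding ambiguous_points_def
proof (rule thin_UN)
  show "finite {G. G face_of C \<and> G \<noteq> {}}"
    using assms finite_polyhedron_faces[of C] by (simp add: polyhedral_cone_def)
  show "thin (collapsing_points C G)" if "G \<in> {G. G face_of C \<and> G \<noteq> {}}" for G
    using that assms polyhedral_cone_face[of C G] thin_collapsing_points
    by (auto simp: polyhedral_cone_def)
qed

text \<open>The region of \<open>G\<close> contains \<open>x\<close>. If the region of \<open>F\<close> does too, the nearest point lies in \<open>F\<close>,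
  so \<open>G \<subseteq> F\<close>; genericity forbids that \<open>F \<inter> G\<close> has smaller dimension than \<open>F\<close>, so \<open>F = G\<close>.\<close>

lemma V_eq_face_dimension:
  fixes C :: "'a::euclidean_space set"
  assumes C: "polyhedral_cone C" and x: "x \<notin> ambiguous_points C"
    and G: "G face_of C" "closest_point C x \<in> rel_interior G"
  shows "V k C x = of_bool (aff_dim G = int k)"
proof -
  let ?p = "closest_point C x"
  have cl: "closed C" "convex C" "polyhedron C"
    using C polyhedron_imp_closed polyhedron_imp_convex by (auto simp: polyhedral_cone_def)
  have pG: "?p \<in> G" "G \<noteq> {}" using G(2) rel_interior_subset by blast+
  have region: "x \<in> face_region C F \<longleftrightarrow> F = G" if F: "F face_of C" for F
  proof
    assume "F = G"
    then show "x \<in> face_region C F"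
      using mem_face_region_iff[OF cl(1,2) face_of_imp_subset[OF F]] pG(1)
        residual_in_normal_cone[OF cl(1,2) G] by simp
  next
    assume "x \<in> face_region C F"
    then have p: "?p \<in> F" "x - ?p \<in> normal_cone C F"
      using mem_face_region_iff[OF cl(1,2) face_of_imp_subset[OF F]] by auto
    have "x \<notin> collapsing_points C G"
      using x G(1) pG(2) unfolding ambiguous_points_def by blast
    then have "aff_dim (F \<inter> G) = aff_dim F"
      using aff_dim_le_if_not_collapsing[OF _ F] p pG(1) by blast
    moreover have "F \<inter> G face_of F"
      using F G(1) by (metis face_of_Int face_of_face inf_le1)
    ultimately have "F \<inter> G = F"
      using face_of_aff_dim_lt[OF face_of_imp_convex[OF F], of "F \<inter> G"] by force
    moreover have "G \<subseteq> F"
      using subset_of_face_of[OF F face_of_imp_subset[OF G(1)]] p(1) G(2) by blast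
    ultimately show "F = G" by blast
  qed
  have fin: "finite (k_faces k C)"
    using finite_polyhedron_faces[OF cl(3)] unfolding k_faces_def by simp
  have "V k C x = (\<Sum>F\<in>k_faces k C. if F = G then 1 else 0)"
    unfolding V_def by (intro sum.cong) (auto simp: k_faces_def region indicator_def)
  also have "\<dots> = of_bool (G \<in> k_faces k C)"
    using fin by simp
  finally show ?thesis
    using G(1) pG(2) by (simp add: k_faces_def)
qed

section \<open>Cutting by a hyperplane\<close>

lemma cut_face_interior_halfspace:
  fixes C :: "'a::euclidean_space set"
  assumes "G face_of C" "p \<in> rel_interior G" "a \<bullet> p < 0"
  defines "L \<equiv> {x. a \<bullet> x \<le> 0}"
  shows "G \<inter> L face_of C \<inter> L" "p \<in> rel_interior (G \<inter> L)" "aff_dim (G \<inter> L) = aff_dim G"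
proof -
  have convG: "convex G" using assms(1) face_of_imp_convex by blast
  have convL: "convex L" unfolding L_def by (rule convex_halfspace_le)
  have pL: "p \<in> interior L"
    using assms(3) unfolding L_def by (cases "a = 0") auto
  then have pL': "p \<in> rel_interior L"
    using interior_subset_rel_interior by blast
  show "G \<inter> L face_of C \<inter> L"
    by (rule face_of_slice[OF assms(1) convL])
  show "p \<in> rel_interior (G \<inter> L)"
    using convex_rel_interior_inter_two[OF convG convL] assms(2) pL' by blast
  show "aff_dim (G \<inter> L) = aff_dim G"
    using aff_dim_convex_Int_nonempty_interior[OF convG, of L] pL assms(2) rel_interior_subset
    by blast
qed

text \<open>The slice \<open>G \<inter> H\<close> is a face of both halves of \<open>C\<close>, not only of \<open>C \<inter> H\<close>, because \<open>H\<close> supports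
  each half. This is what makes the contributions of a half and of \<open>C \<inter> H\<close> agree at a nearest point
  on \<open>H\<close>.\<close>

lemma cut_face_hyperplane:
  fixes C :: "'a::euclidean_space set"
  assumes "convex C" "G face_of C" "q \<in> rel_interior G" "a \<bullet> q = 0"
  defines "H \<equiv> {x. a \<bullet> x = 0}"
  shows "G \<inter> H face_of C \<inter> H"
    and "G \<inter> H face_of C \<inter> {x. a \<bullet> x \<le> 0}"
    and "G \<inter> H face_of C \<inter> {x. 0 \<le> a \<bullet> x}"
    and "q \<in> rel_interior (G \<inter> H)"
proof -
  have H: "convex H" "affine H"
    unfolding H_def by (rule convex_hyperplane, rule affine_hyperplane)
  have "q \<in> rel_interior H"
    using assms(4) rel_interior_affine[OF H(2)] by (simp add: H_def)
  then show "q \<in> rel_interior (G \<inter> H)"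
    using convex_rel_interior_inter_two[OF face_of_imp_convex[OF assms(2)] H(1)] assms(3) by blast
  show *: "G \<inter> H face_of C \<inter> H"
    by (rule face_of_slice[OF assms(2) H(1)])
  have "C \<inter> {x. a \<bullet> x \<le> 0} \<inter> H face_of C \<inter> {x. a \<bullet> x \<le> 0}"
    unfolding H_def using assms(1) convex_halfspace_le
    by (intro face_of_Int_supporting_hyperplane_le convex_Int) auto
  moreover have "C \<inter> {x. a \<bullet> x \<le> 0} \<inter> H = C \<inter> H" by (auto simp: H_def)
  ultimately show "G \<inter> H face_of C \<inter> {x. a \<bullet> x \<le> 0}"
    using face_of_trans[OF *] by simp
  have "C \<inter> {x. 0 \<le> a \<bullet> x} \<inter> H face_of C \<inter> {x. 0 \<le> a \<bullet> x}"
    unfolding H_def using assms(1) convex_halfspace_ge[of 0 a]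
    by (intro face_of_Int_supporting_hyperplane_ge convex_Int) auto
  moreover have "C \<inter> {x. 0 \<le> a \<bullet> x} \<inter> H = C \<inter> H" by (auto simp: H_def)
  ultimately show "G \<inter> H face_of C \<inter> {x. 0 \<le> a \<bullet> x}"
    using face_of_trans[OF *] by simp
qed

lemma closest_point_subset:
  fixes C D :: "'a::euclidean_space set"
  assumes "closed C" "closed D" "convex D" "D \<subseteq> C" "closest_point C x \<in> D"
  shows "closest_point D x = closest_point C x"
  using closest_point_unique[OF assms(3,2,5), of x] closest_point_le[OF assms(1)] assms(4)
  by (metis subsetD)

text \<open>If the nearest point \<open>q\<close> of the far half were off the hyperplane, one could move from \<open>q\<close> towards
  the nearest point \<open>p\<close> of all of \<open>C\<close> without leaving that half. The obtuse angle conditions at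
  \<open>q\<close> and at \<open>p\<close> then add up to \<open>p = q\<close>, although \<open>p\<close> and \<open>q\<close> are on different sides.\<close>

lemma closest_point_opposite_halfspace:
  fixes C :: "'a::euclidean_space set"
  assumes C: "closed C" "convex C" and neg: "a \<bullet> closest_point C x < 0"
    and ne: "C \<inter> {x. 0 \<le> a \<bullet> x} \<noteq> {}"
  shows "a \<bullet> closest_point (C \<inter> {x. 0 \<le> a \<bullet> x}) x = 0"
proof -
  define D p q where "D = C \<inter> {x. 0 \<le> a \<bullet> x}" and "p = closest_point C x" and "q = closest_point D x"
  have D: "closed D" "convex D" "D \<noteq> {}"
    using C ne closed_halfspace_ge[of 0 a] convex_halfspace_ge[of 0 a]
    by (auto simp: D_def closed_Int convex_Int)
  have q: "q \<in> C" "0 \<le> a \<bullet> q"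
    using closest_point_in_set[OF D(1,3)] by (auto simp: q_def D_def)
  have p: "p \<in> C"
    using closest_point_in_set[OF C(1)] q(1) by (auto simp: p_def)
  have "\<not> 0 < a \<bullet> q"
  proof
    assume pos: "0 < a \<bullet> q"
    have neg': "a \<bullet> p < 0" using neg by (simp add: p_def)
    \<comment> \<open>the parameter at which the segment from \<open>q\<close> to \<open>p\<close> crosses the hyperplane\<close>
    define t where "t = (a \<bullet> q) / (a \<bullet> q - a \<bullet> p)"
    have t: "0 < t" "t \<le> 1" using pos neg' by (auto simp: t_def divide_simps)
    define z where "z = (1 - t) *\<^sub>R q + t *\<^sub>R p"
    have zq: "z - q = t *\<^sub>R (p - q)" by (simp add: z_def algebra_simps)
    have "a \<bullet> z = a \<bullet> q - t * (a \<bullet> q - a \<bullet> p)"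
      by (simp add: z_def inner_add_right algebra_simps)
    also have "\<dots> = 0" using pos neg' by (simp add: t_def)
    finally have "z \<in> D"
      using convexD_alt[OF C(2) q(1) p, of t] t by (simp add: D_def z_def)
    then have "(x - q) \<bullet> (z - q) \<le> 0"
      unfolding q_def by (intro closest_point_dot D)
    then have 1: "(x - q) \<bullet> (p - q) \<le> 0"
      using t(1) by (simp add: zq mult_le_0_iff)
    have 2: "(x - p) \<bullet> (q - p) \<le> 0"
      unfolding p_def by (intro closest_point_dot C q(1))
    have "(p - q) \<bullet> (p - q) = (x - q) \<bullet> (p - q) + (x - p) \<bullet> (q - p)"
      by (simp add: inner_diff_left inner_diff_right)
    then have "(p - q) \<bullet> (p - q) \<le> 0" using 1 2 by linarith
    then have "p = q"
      by (metis antisym inner_eq_zero_iff inner_ge_zero right_minus_eq)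
    then show False using pos neg' by simp
  qed
  then show ?thesis using q(2) by (simp add: q_def D_def)
qed

lemma V_split_at_generic_point:
  fixes C :: "'a::euclidean_space set"
  assumes C: "polyhedral_cone C" and le: "a \<bullet> closest_point C x \<le> 0"
  defines "H \<equiv> {x. a \<bullet> x = 0}" and "L \<equiv> {x. a \<bullet> x \<le> 0}" and "R \<equiv> {x. 0 \<le> a \<bullet> x}"
  assumes generic: "x \<notin> collapsing_points C H" "x \<notin> ambiguous_points C"
    "x \<notin> ambiguous_points (C \<inter> H)" "x \<notin> ambiguous_points (C \<inter> L)" "x \<notin> ambiguous_points (C \<inter> R)"
  shows "V k C x + V k (C \<inter> H) x = V k (C \<inter> L) x + V k (C \<inter> R) x"
proof -
  let ?p = "closest_point C x"
  have cones: "polyhedral_cone (C \<inter> H)" "polyhedral_cone (C \<inter> L)" "polyhedral_cone (C \<inter> R)"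
    unfolding H_def L_def R_def
    using C polyhedral_cone_Int polyhedral_cone_hyperplane polyhedral_cone_halfspace_le
      polyhedral_cone_halfspace_ge by blast+
  have cc: "closed D" "convex D" "0 \<in> D" if "polyhedral_cone D" for D :: "'a set"
    using that polyhedron_imp_closed polyhedron_imp_convex unfolding polyhedral_cone_def by blast+
  have sub: "C \<inter> H \<subseteq> C \<inter> L" "C \<inter> H \<subseteq> C \<inter> R"
    by (auto simp: H_def L_def R_def)
  have p: "?p \<in> C"
    using closest_point_in_set cc[OF C] by blast
  obtain G where G: "G face_of C" "?p \<in> rel_interior G"
    using face_containing_in_rel_interior C p unfolding polyhedral_cone_def by blast
  have V_C: "V k C x = of_bool (aff_dim G = int k)"
    by (rule V_eq_face_dimension[OF C generic(2) G])
  show ?thesis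
  proof (cases "a \<bullet> ?p = 0")
    case True
    note cut = cut_face_hyperplane[OF cc(2)[OF C] G True, folded H_def L_def R_def]
    have pH: "?p \<in> C \<inter> H" using p True by (simp add: H_def)
    have proj: "closest_point (C \<inter> H) x = ?p" "closest_point (C \<inter> L) x = ?p"
      "closest_point (C \<inter> R) x = ?p"
      using closest_point_subset[OF cc(1)[OF C] cc(1,2)] cones pH sub by blast+
    have "aff_dim (G \<inter> H) = aff_dim G"
      using aff_dim_le_if_not_collapsing[OF generic(1) G(1) _
          residual_in_normal_cone[OF cc(1,2)[OF C] G]] G(2) rel_interior_subset pH by blast
    then show ?thesis
      using V_C V_eq_face_dimension[OF cones(1) generic(3) cut(1)]
        V_eq_face_dimension[OF cones(2) generic(4) cut(2)]
        V_eq_face_dimension[OF cones(3) generic(5) cut(3)] cut(4) proj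
      by simp
  next
    case False
    then have neg: "a \<bullet> ?p < 0" using le by simp
    have pL: "?p \<in> C \<inter> L" using p neg by (simp add: L_def)
    then have "closest_point (C \<inter> L) x = ?p"
      by (intro closest_point_subset cc C cones) auto
    then have V_L: "V k (C \<inter> L) x = V k C x"
      using V_C V_eq_face_dimension[OF cones(2) generic(4)]
        cut_face_interior_halfspace[OF G neg, folded L_def] by simp
    define q where "q = closest_point (C \<inter> R) x"
    have "C \<inter> R \<noteq> {}" using cc(3)[OF cones(3)] by blast
    then have aq: "a \<bullet> q = 0" and q: "q \<in> C"
      using closest_point_opposite_halfspace[OF cc(1,2)[OF C] neg]
        closest_point_in_set[OF cc(1)[OF cones(3)], of x] by (auto simp: q_def R_def)
    have qH: "closest_point (C \<inter> H) x = q"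
      unfolding q_def using aq q sub
      by (intro closest_point_subset cc cones) (auto simp: H_def q_def)
    obtain K where K: "K face_of C" "q \<in> rel_interior K"
      using face_containing_in_rel_interior C q unfolding polyhedral_cone_def by blast
    note cut = cut_face_hyperplane[OF cc(2)[OF C] K aq, folded H_def L_def R_def]
    have "V k (C \<inter> R) x = V k (C \<inter> H) x"
      using V_eq_face_dimension[OF cones(1) generic(3) cut(1)]
        V_eq_face_dimension[OF cones(3) generic(5) cut(3)] cut(4) qH
      by (simp add: q_def)
    then show ?thesis using V_L by simp
  qed
qed

text \<open>The two strict sides of the hyperplane are interchanged by replacing \<open>a\<close> with \<open>- a\<close>.\<close>

lemma V_split_off_thin:
  fixes C :: "'a::euclidean_space set" and a :: 'a
  assumes C: "polyhedral_cone C"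
  defines "H \<equiv> {x. a \<bullet> x = 0}" and "L \<equiv> {x. a \<bullet> x \<le> 0}" and "R \<equiv> {x. 0 \<le> a \<bullet> x}"
  shows "thin {x. V k C x + V k (C \<inter> H) x \<noteq> V k (C \<inter> L) x + V k (C \<inter> R) x}"
proof (rule thin_subset)
  have cones: "polyhedral_cone (C \<inter> H)" "polyhedral_cone (C \<inter> L)" "polyhedral_cone (C \<inter> R)"
    unfolding H_def L_def R_def
    using C polyhedral_cone_Int polyhedral_cone_hyperplane polyhedral_cone_halfspace_le
      polyhedral_cone_halfspace_ge by blast+
  let ?E = "collapsing_points C H \<union> ambiguous_points C \<union> ambiguous_points (C \<inter> H)
    \<union> ambiguous_points (C \<inter> L) \<union> ambiguous_points (C \<inter> R)"
  show "thin ?E"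
    by (intro thin_Un thin_ambiguous_points thin_collapsing_points C cones) (simp add: H_def)
  have "V k C x + V k (C \<inter> H) x = V k (C \<inter> L) x + V k (C \<inter> R) x" if "x \<notin> ?E" for x
  proof (cases "a \<bullet> closest_point C x \<le> 0")
    case True
    then show ?thesis
      using V_split_at_generic_point[OF C True] that unfolding H_def L_def R_def by blast
  next
    case False
    then have "(- a) \<bullet> closest_point C x \<le> 0" by simp
    from V_split_at_generic_point[OF C this, of k] that
    show ?thesis by (simp add: H_def L_def R_def add.commute)
  qed
  then show "{x. V k C x + V k (C \<inter> H) x \<noteq> V k (C \<inter> L) x + V k (C \<inter> R) x} \<subseteq> ?E" by blast
qed

section \<open>The valuation property modulo lower-dimensional cones\<close>

lemma simple_class_hom: "simple_class \<in> hom cone_functions simple_functions"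
proof -
  interpret comm_group cone_functions by (rule comm_group_cone_functions)
  have "normal low_dim_functions cone_functions"
    using normal_iff_subgroup subgroup_low_dim_functions by blast
  from normal.r_coset_hom_Mod[OF this] show ?thesis
    unfolding simple_class_def simple_functions_def .
qed

lemma simple_class_eqI:
  assumes "f \<in> carrier cone_functions" "g \<in> carrier cone_functions"
    and "(\<lambda>x. f x - g x) \<in> low_dim_functions"
  shows "simple_class f = simple_class g"
proof -
  interpret comm_group cone_functions by (rule comm_group_cone_functions)
  have "f = (\<lambda>x. f x - g x) \<otimes>\<^bsub>cone_functions\<^esub> g"
    by (simp add: mult_cone_functions)
  then have "f \<in> low_dim_functions #>\<^bsub>cone_functions\<^esub> g"
    unfolding r_coset_def using assms(3) by blast
  then show ?thesis
    unfolding simple_class_def using repr_independence assms(2) subgroup_low_dim_functions by metis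
qed

theorem theorem3p2:
  fixes C H H_le H_ge :: "(real ^ 'n) set" and a :: "real ^ 'n" and k :: nat
  assumes "k \<le> CARD('n)"
    and "polyhedral_cone C"
    and "a \<noteq> 0"
    and "H = {x. a \<bullet> x = 0}"
    and "H_le = {x. a \<bullet> x \<le> 0}"
    and "H_ge = {x. a \<bullet> x \<ge> 0}"
  shows "simple_class (V k C) =
    simple_class (V k (C \<inter> H_le)) \<otimes>\<^bsub>simple_functions\<^esub> simple_class (V k (C \<inter> H_ge))
      \<otimes>\<^bsub>simple_functions\<^esub> inv\<^bsub>simple_functions\<^esub> simple_class (V k (C \<inter> H))"
proof -
  interpret G: comm_group "cone_functions :: (real ^ 'n \<Rightarrow> int) monoid"
    by (rule comm_group_cone_functions)
  interpret S: comm_group "simple_functions :: (real ^ 'n \<Rightarrow> int) set monoid"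
    by (rule comm_group_simple_functions)
  interpret quot: group_hom cone_functions simple_functions
    "simple_class :: (real ^ 'n \<Rightarrow> int) \<Rightarrow> _"
    by unfold_locales (rule simple_class_hom)
  have cones: "polyhedral_cone (C \<inter> H)" "polyhedral_cone (C \<inter> H_le)" "polyhedral_cone (C \<inter> H_ge)"
    using assms(2,4-6) polyhedral_cone_Int polyhedral_cone_hyperplane polyhedral_cone_halfspace_le
      polyhedral_cone_halfspace_ge by blast+
  note V_carrier = cones[THEN V_in_cone_functions, of k] V_in_cone_functions[OF assms(2), of k]
  let ?g = "\<lambda>x. V k (C \<inter> H_le) x + V k (C \<inter> H_ge) x - V k (C \<inter> H) x"
  have g: "?g \<in> carrier cone_functions"
    by (intro cone_functions_diff cone_functions_add V_carrier)
  have "{x. V k C x - ?g x \<noteq> 0} = {x. V k C x + V k (C \<inter> H) x \<noteq> V k (C \<inter> H_le) x + V k (C \<inter> H_ge) x}"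
    by auto
  then have "(\<lambda>x. V k C x - ?g x) \<in> low_dim_functions"
    using V_split_off_thin[OF assms(2), of k a] assms(4-6)
    by (intro low_dim_if_thin_support cone_functions_diff V_carrier g) simp
  then have "simple_class (V k C) = simple_class ?g"
    by (intro simple_class_eqI V_carrier g)
  also have "?g = V k (C \<inter> H_le) \<otimes>\<^bsub>cone_functions\<^esub> V k (C \<inter> H_ge)
      \<otimes>\<^bsub>cone_functions\<^esub> inv\<^bsub>cone_functions\<^esub> V k (C \<inter> H)"
    by (simp add: mult_cone_functions inv_cone_functions V_carrier)
  also have "simple_class \<dots> =
    simple_class (V k (C \<inter> H_le)) \<otimes>\<^bsub>simple_functions\<^esub> simple_class (V k (C \<inter> H_ge))
      \<otimes>\<^bsub>simple_functions\<^esub> inv\<^bsub>simple_functions\<^esub> simple_class (V k (C \<inter> H))"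
    by (simp add: V_carrier)
  finally show ?thesis .
qed

end
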